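(* Let $(X,d)$ be a nonempty compact metric space and $f:X\to X$ a homeomorphism. Assume that $(X,f)$ is not minimal and has the gluing orbit property. Then $(X,f)$ has positive topological entropy, i.e. $h(f)>0$.
   Context: $(X,f)$ is minimal if for every $x\in X$ the full orbit $\{f^n(x):n\in\mathbb{Z}\}$ is dense in $X$. Gluing orbit property. An orbit sequence of rank $k$ ($k\ge 1$) is a finite sequence $\mathscr{C}=\{(x_j,m_j)\in X\times\mathbb{Z}^+: j=1,\dots,k\}$, where $\mathbb{Z}^+=\{1,2,\dots\}$. A gap for it is a $(k-1)$-tuple $\mathscr{G}=\{t_j\in\mathbb{Z}^+: j=1,\dots,k-1\}$ (empty if $k=1$). For $\varepsilon>0$, $(\mathscr{C},\mathscr{G})$ is $\varepsilon$-shadowed by $z\in X$ if for every $j=1,\dots,k$, $d(f^{s_j+l}(z),f^l(x_j))<\varepsilon$ for every $l=0,1,\dots,m_j-1$, where $s_1=0$ and $s_j=\sum_{i=1}^{j-1}(m_i+t_i-1)$ for $j=2,\dots,k$. $(X,f)$ has the gluing orbit property if for every $\varepsilon>0$ there is $M(\varepsilon)>0$ such that for any orbit sequence $\mathscr{C}$ there is a gap $\mathscr{G}$ with $\max\mathscr{G}\le M(\varepsilon)$ such that $(\mathscr{C},\mathscr{G})$ can be $\varepsilon$-shadowed by some $z\in X$. Topological entropy $h(f)=\lim_{\varepsilon\to0}\limsup_{n\to\infty}\frac{1}{n}\ln s(n,\varepsilon)$, where $s(n,\varepsilon)$ is the maximal cardinality of a set $E\subset X$ such that any distinct $x,y\in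 E$ satisfy $d(f^k(x),f^k(y))>\varepsilon$ for some $k\in\{0,\dots,n-1\}$. *)

theory Defs
  imports "HOL-Analysis.Analysis"
begin

text \<open>
  The metric space is a subset \<open>X\<close> of a type of class \<^class>\<open>metric_space\<close>, with the induced
  metric; the values of \<open>f\<close> outside \<open>X\<close> are irrelevant.
\<close>

definition int_iterate :: "'a set \<Rightarrow> ('a \<Rightarrow> 'a) \<Rightarrow> int \<Rightarrow> 'a \<Rightarrow> 'a" where
  "int_iterate X f n x =
     (if n \<ge> 0 then (f ^^ nat n) x else (inv_into X f ^^ nat (- n)) x)"

definition minimal_system :: "'a::metric_space set \<Rightarrow> ('a \<Rightarrow> 'a) \<Rightarrow> bool" where
  "minimal_system X f \<longleftrightarrow>
     (\<forall>x\<in>X. X \<subseteq> closure (range (\<lambda>n::int. int_iterate X f n x)))"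

text \<open>
  An orbit sequence of rank \<open>k\<close> is given by functions \<open>x\<close>, \<open>m\<close> of which only the values on
  \<open>{1..k}\<close> are relevant, a gap by a function \<open>t\<close> of which only the values on \<open>{1..<k}\<close> are.
\<close>

definition orbit_sequence ::
    "'a set \<Rightarrow> nat \<Rightarrow> (nat \<Rightarrow> 'a) \<Rightarrow> (nat \<Rightarrow> nat) \<Rightarrow> bool" where
  "orbit_sequence X k x m \<longleftrightarrow> k \<ge> 1 \<and> (\<forall>j\<in>{1..k}. x j \<in> X \<and> m j \<ge> 1)"

definition is_gap :: "nat \<Rightarrow> (nat \<Rightarrow> nat) \<Rightarrow> bool" where
  "is_gap k t \<longleftrightarrow> (\<forall>j\<in>{1..<k}. t j \<ge> 1)"

text \<open>For \<open>m i, t i \<ge> 1\<close> the subtraction on \<^typ>\<open>nat\<close> does not truncate.\<close>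

definition start_time :: "(nat \<Rightarrow> nat) \<Rightarrow> (nat \<Rightarrow> nat) \<Rightarrow> nat \<Rightarrow> nat" where
  "start_time m t j = (\<Sum>i\<in>{1..<j}. (m i + t i - 1))"

definition shadowed ::
    "('a::metric_space \<Rightarrow> 'a) \<Rightarrow> real \<Rightarrow> nat \<Rightarrow> (nat \<Rightarrow> 'a) \<Rightarrow> (nat \<Rightarrow> nat) \<Rightarrow> (nat \<Rightarrow> nat) \<Rightarrow> 'a \<Rightarrow> bool"
  where
  "shadowed f \<epsilon> k x m t z \<longleftrightarrow>
     (\<forall>j\<in>{1..k}. \<forall>l<m j. dist ((f ^^ (start_time m t j + l)) z) ((f ^^ l) (x j)) < \<epsilon>)"

definition gluing_orbit_property :: "'a::metric_space set \<Rightarrow> ('a \<Rightarrow> 'a) \<Rightarrow> bool" where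
  "gluing_orbit_property X f \<longleftrightarrow>
     (\<forall>\<epsilon>>0. \<exists>M::real. M > 0 \<and>
        (\<forall>k x m. orbit_sequence X k x m \<longrightarrow>
           (\<exists>t. is_gap k t \<and> (\<forall>j\<in>{1..<k}. real (t j) \<le> M) \<and>
              (\<exists>z\<in>X. shadowed f \<epsilon> k x m t z))))"

definition separated_set ::
    "'a::metric_space set \<Rightarrow> ('a \<Rightarrow> 'a) \<Rightarrow> nat \<Rightarrow> real \<Rightarrow> 'a set \<Rightarrow> bool" where
  "separated_set X f n \<epsilon> E \<longleftrightarrow>
     E \<subseteq> X \<and> (\<forall>x\<in>E. \<forall>y\<in>E. x \<noteq> y \<longrightarrow> (\<exists>k<n. dist ((f ^^ k) x) ((f ^^ k) y) > \<epsilon>))"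

text \<open>
  If \<open>X\<close> is compact, \<open>f\<close> maps \<open>X\<close> continuously to itself and \<open>\<epsilon> > 0\<close>, then separated sets are
  finite with bounded cardinality, so that this supremum in \<^typ>\<open>nat\<close> is a maximum.
\<close>

definition max_separated :: "'a::metric_space set \<Rightarrow> ('a \<Rightarrow> 'a) \<Rightarrow> nat \<Rightarrow> real \<Rightarrow> nat" where
  "max_separated X f n \<epsilon> = Sup {card E |E. finite E \<and> separated_set X f n \<epsilon> E}"

text \<open>
  The entropy may be \<open>\<infinity>\<close>. Under the same conditions the inner \<^term>\<open>limsup\<close> is antitone in
  \<open>\<epsilon> > 0\<close>, hence the limit exists in \<^typ>\<open>ereal\<close>.
\<close>

definition topological_entropy :: "'a::metric_space set \<Rightarrow> ('a \<Rightarrow> 'a) \<Rightarrow> ereal" where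
  "topological_entropy X f =
     Lim (at_right 0)
       (\<lambda>\<epsilon>::real. limsup (\<lambda>n. ereal (1 / real n * ln (real (max_separated X f n \<epsilon>)))))"

end

theory Submission
  imports Defs
begin

text \<open>
  If the full orbit of some \<open>p\<close> is not dense, then its forward orbit stays at distance at least
  \<open>3 \<epsilon>\<close> from some \<open>q\<close>, for some \<open>\<epsilon> > 0\<close>. An orbit can therefore be used to transmit a message:
  a stretch of time that shadows \<open>p\<close> is silence, a visit to \<open>q\<close> is a signal, and the letter sent is
  the length of the silence between two signals. By the gluing orbit property every word
  \<open>w 0, \<dots>, w (n - 1)\<close> is realised by a point, namely by one that \<open>\<epsilon>\<close>-shadows, in turn, \<open>p\<close> for
  \<open>(w i + 1) M\<close> steps and \<open>q\<close> for one step, where \<open>M\<close> bounds all gaps.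

  The gaps depend on the word and blur the timing. But there are at most \<open>M ^ (2 n)\<close> ways to choose
  them, whereas an alphabet with \<open>2 M\<^sup>2\<close> letters gives \<open>2 ^ n * M ^ (2 n)\<close> words, so by the
  pigeonhole principle \<open>2 ^ n\<close> words share their gaps (\<open>many_words_with_equal_gaps\<close>). Two of these
  are in step up to the first letter in which they differ. There the word with the smaller letter
  signals at a moment when the other one is still silent, because different letters stand for
  silences whose lengths differ by at least \<open>M\<close>. Hence the two points are \<open>\<epsilon>\<close>-separated
  (\<open>equal_gaps_imp_separated\<close>). All this happens before time \<open>n T\<close> with \<open>T\<close> independent of \<open>n\<close>, so
  that the entropy is at least \<open>ln 2 / T\<close>.

  Compactness serves to make the entropy behave as expected: it bounds the cardinality of separated
  sets, which makes \<^const>\<open>max_separated\<close> a true maximum that decreases in the scale.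
\<close>

section \<open>Separated sets in compact systems\<close>

lemma continuous_on_funpow:
  fixes f :: "'a::topological_space \<Rightarrow> 'a"
  assumes "continuous_on X f" and "f ` X \<subseteq> X"
  shows "continuous_on X (f ^^ n)" and "(f ^^ n) ` X \<subseteq> X"
proof (induction n)
  case (Suc n)
  {
    case 1
    show ?case
      using continuous_on_compose[OF Suc.IH(1) continuous_on_subset[OF assms(1) Suc.IH(2)]]
      by simp
  next
    case 2
    show ?case
      using Suc.IH(2) assms(2) by auto
  }
qed auto

text \<open>
  The first \<open>n\<close> iterates are uniformly equicontinuous, so a separated set has at most one point in
  each of finitely many balls that cover \<open>X\<close>.
\<close>

lemma separated_sets_bounded:
  fixes X :: "'a::metric_space set"
  assumes "compact X" and "continuous_on X f" and "f ` X \<subseteq> X" and "\<epsilon> > 0"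
  shows "bdd_above {card E |E. finite E \<and> separated_set X f n \<epsilon> E}"
proof -
  have "\<forall>k. \<exists>d>0. \<forall>x\<in>X. \<forall>y\<in>X. dist y x < d \<longrightarrow> dist ((f ^^ k) y) ((f ^^ k) x) < \<epsilon>"
    using compact_uniformly_continuous[OF continuous_on_funpow(1)[OF assms(2,3)] assms(1)] assms(4)
    unfolding uniformly_continuous_on_def by blast
  then obtain d where d: "d k > 0"
    "x \<in> X \<Longrightarrow> y \<in> X \<Longrightarrow> dist y x < d k \<Longrightarrow> dist ((f ^^ k) y) ((f ^^ k) x) < \<epsilon>" for k x y
    by metis
  define r where "r = Min (insert 1 (d ` {..<n}))"
  have r: "r \<le> d k" if "k < n" for k
    using that by (simp add: r_def)
  have "r > 0" using d(1) by (auto simp: r_def)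
  then obtain C where C: "finite C" "X \<subseteq> (\<Union>c\<in>C. ball c (r / 2))"
    using assms(1) unfolding compact_eq_totally_bounded by (meson half_gt_zero)
  have "card E \<le> card C" if E: "separated_set X f n \<epsilon> E" for E
  proof -
    have "E \<subseteq> X" using E by (simp add: separated_set_def)
    then obtain c where c: "x \<in> E \<Longrightarrow> c x \<in> C" "x \<in> E \<Longrightarrow> dist (c x) x < r / 2" for x
      using C(2) by (simp add: subset_iff) metis
    have "inj_on c E"
    proof (rule inj_onI, rule ccontr)
      fix x y assume xy: "x \<in> E" "y \<in> E" "c x = c y" "x \<noteq> y"
      then obtain k where k: "k < n" "dist ((f ^^ k) x) ((f ^^ k) y) > \<epsilon>"
        using E unfolding separated_set_def by blast
      have "dist x y < r"
        using c(2)[OF xy(1)] c(2)[OF xy(2)] xy(3) by (metis dist_commute dist_triangle_half_r)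
      then show False
        using d(2)[of y x k] r[OF k(1)] k(2) xy \<open>E \<subseteq> X\<close> by auto
    qed
    then show ?thesis
      using c(1) C(1) by (intro card_inj_on_le[of c]) auto
  qed
  then show ?thesis
    by (intro bdd_aboveI[of _ "card C"]) auto
qed

lemma card_le_max_separated:
  fixes X :: "'a::metric_space set"
  assumes "compact X" and "continuous_on X f" and "f ` X \<subseteq> X" and "\<epsilon> > 0"
    and "finite E" and "separated_set X f n \<epsilon> E"
  shows "card E \<le> max_separated X f n \<epsilon>"
  unfolding max_separated_def
  by (rule cSup_upper) (use assms separated_sets_bounded[OF assms(1-4)] in auto)

lemma max_separated_pos:
  fixes X :: "'a::metric_space set"
  assumes "compact X" and "continuous_on X f" and "f ` X \<subseteq> X" and "\<epsilon> > 0" and "X \<noteq> {}"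
  shows "max_separated X f n \<epsilon> \<ge> 1"
proof -
  obtain x where "x \<in> X" using assms(5) by blast
  then show ?thesis
    using card_le_max_separated[OF assms(1-4), of "{x}" n] by (simp add: separated_set_def)
qed

lemma max_separated_antimono:
  fixes X :: "'a::metric_space set"
  assumes "compact X" and "continuous_on X f" and "f ` X \<subseteq> X" and "\<epsilon> > 0" and "\<epsilon> \<le> \<epsilon>'"
  shows "max_separated X f n \<epsilon>' \<le> max_separated X f n \<epsilon>"
proof -
  have "separated_set X f n \<epsilon>' {}"
    by (simp add: separated_set_def)
  then show ?thesis
    unfolding max_separated_def[of X f n \<epsilon>']
  proof (intro cSup_least)
    fix c assume "c \<in> {card E |E. finite E \<and> separated_set X f n \<epsilon>' E}"
    then obtain E where E: "c = card E" "finite E" "separated_set X f n \<epsilon>' E" by blast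
    have "separated_set X f n \<epsilon> E"
      using E(3) assms(5) unfolding separated_set_def by (meson le_less_trans)
    then show "c \<le> max_separated X f n \<epsilon>"
      using card_le_max_separated[OF assms(1-4) E(2)] E(1) by simp
  qed blast
qed

section \<open>Entropy from exponentially many separated points\<close>

text \<open>An antitone function tends to its supremum at the left end of its domain.\<close>

lemma Lim_at_right_ge_of_antimono:
  fixes F :: "real \<Rightarrow> ereal"
  assumes anti: "\<And>x y. 0 < x \<Longrightarrow> x \<le> y \<Longrightarrow> F y \<le> F x" and "a > 0"
  shows "F a \<le> Lim (at_right 0) F"
proof -
  define L where "L = (SUP x\<in>{0<..}. F x)"
  have upper: "F x \<le> L" if "x > 0" for x
    using that unfolding L_def by (intro SUP_upper) auto
  have "(F \<longlongrightarrow> L) (at_right 0)"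
  proof (rule order_tendstoI)
    fix b assume "b < L"
    then obtain x where x: "x > 0" "b < F x"
      unfolding L_def less_SUP_iff by auto
    then show "eventually (\<lambda>y. b < F y) (at_right 0)"
      unfolding eventually_at_right_field using anti
      by (intro exI[of _ x]) (meson less_eq_real_def less_le_trans)
  next
    fix b assume "L < b"
    then show "eventually (\<lambda>y. F y < b) (at_right 0)"
      unfolding eventually_at_right_field using upper
      by (intro exI[of _ 1]) (meson le_less_trans zero_less_one)
  qed
  then have "Lim (at_right 0) F = L"
    by (intro tendsto_Lim) auto
  then show ?thesis
    using upper[OF assms(2)] by simp
qed

text \<open>
  The growth rate at the single scale \<open>\<epsilon>\<close> bounds the entropy from below by monotonicity, and the
  times \<open>n T\<close> suffice for a limes superior.
\<close>

lemma topological_entropy_ge: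
  fixes X :: "'a::metric_space set"
  assumes X: "compact X" "continuous_on X f" "f ` X \<subseteq> X" and "X \<noteq> {}"
    and "\<epsilon> > 0" and "T > 0"
    and many: "\<And>n. n \<ge> 1 \<Longrightarrow>
      \<exists>E. finite E \<and> separated_set X f (n * T) \<epsilon> E \<and> card E \<ge> 2 ^ n"
  shows "topological_entropy X f \<ge> ereal (ln 2 / real T)"
proof -
  define rate where "rate = (\<lambda>\<epsilon> n. ereal (1 / real n * ln (real (max_separated X f n \<epsilon>))))"
  have rate_anti: "rate b n \<le> rate a n" if "0 < a" "a \<le> b" for a b n
  proof -
    have "ln (real (max_separated X f n b)) \<le> ln (real (max_separated X f n a))"
      using max_separated_antimono[OF X that, of n] max_separated_pos[OF X _ \<open>X \<noteq> {}\<close>, of b n] that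
      by (intro ln_mono) auto
    then show ?thesis
      unfolding rate_def by (simp add: divide_right_mono)
  qed
  have rate_ge: "ereal (ln 2 / real T) \<le> rate \<epsilon> (Suc n * T)" for n
  proof -
    obtain E where E: "finite E" "separated_set X f (Suc n * T) \<epsilon> E" "card E \<ge> 2 ^ Suc n"
      using many[of "Suc n"] by auto
    have "(2::nat) ^ Suc n \<le> max_separated X f (Suc n * T) \<epsilon>"
      using card_le_max_separated[OF X \<open>\<epsilon> > 0\<close> E(1,2)] E(3) by simp
    then have "real (2 ^ Suc n) \<le> real (max_separated X f (Suc n * T) \<epsilon>)"
      by (rule of_nat_mono)
    then have "ln (real (2 ^ Suc n)) \<le> ln (real (max_separated X f (Suc n * T) \<epsilon>))"
      by (intro ln_mono) auto
    moreover have "ln (real (2 ^ Suc n)) = real (Suc n) * ln 2"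
      by (simp only: of_nat_power of_nat_numeral ln_realpow)
    ultimately have "real (Suc n) * ln 2 / (real (Suc n) * real T)
        \<le> ln (real (max_separated X f (Suc n * T) \<epsilon>)) / (real (Suc n) * real T)"
      by (intro divide_right_mono) (simp_all del: of_nat_Suc)
    moreover have "real (Suc n) * ln 2 / (real (Suc n) * real T) = ln 2 / real T"
      by (rule mult_divide_mult_cancel_left) simp
    ultimately show ?thesis
      unfolding rate_def by (simp del: of_nat_Suc mult_Suc)
  qed
  have "ereal (ln 2 / real T) \<le> limsup (rate \<epsilon> \<circ> (\<lambda>n. Suc n * T))"
    using rate_ge by (intro le_Limsup) (auto intro!: always_eventually)
  also have "\<dots> \<le> limsup (rate \<epsilon>)"
    using \<open>T > 0\<close> by (intro limsup_subseq_mono) (auto intro!: strict_monoI)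
  also have "\<dots> \<le> Lim (at_right 0) (\<lambda>\<epsilon>. limsup (rate \<epsilon>))"
    using rate_anti \<open>\<epsilon> > 0\<close>
    by (intro Lim_at_right_ge_of_antimono) (auto intro!: Limsup_mono always_eventually)
  finally show ?thesis
    unfolding topological_entropy_def rate_def .
qed

section \<open>Words encoded in waiting times\<close>

text \<open>
  Orbit segments are numbered from 1: the odd segment \<open>2 i + 1\<close> is the silence that encodes the
  letter \<open>w i\<close>, and the even segment \<open>2 i + 2\<close> is the signal that ends it.
\<close>

definition signal_points :: "'a \<Rightarrow> 'a \<Rightarrow> nat \<Rightarrow> 'a" where
  "signal_points p q j = (if odd j then p else q)"

definition signal_lengths :: "nat \<Rightarrow> (nat \<Rightarrow> nat) \<Rightarrow> nat \<Rightarrow> nat" where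
  "signal_lengths M w j = (if odd j then Suc (w (j div 2)) * M else 1)"

lemma start_time_Suc:
  "j \<ge> 1 \<Longrightarrow> start_time m t (Suc j) = start_time m t j + (m j + t j - 1)"
  by (simp add: start_time_def atLeastLessThanSuc)

text \<open>
  The crude bound \<open>N M + M\<close> for one segment and the gap after it is all that matters, since it does
  not depend on the number of segments.
\<close>

lemma start_time_signal_less:
  assumes "M \<ge> 1" and "\<And>i. i < n \<Longrightarrow> w i < N"
    and "\<And>j. j \<in> {1..<2 * n} \<Longrightarrow> t j \<le> M" and "1 \<le> j" and "j \<le> 2 * n"
  shows "start_time (signal_lengths M w) t j < n * (2 * (N * M + M))"
proof -
  have term_le: "signal_lengths M w i + t i - 1 \<le> N * M + M" if i: "i \<in> {1..<j}" for i
  proof -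
    have "n \<ge> 1" and "i div 2 < n" using i assms(5) by auto
    then have "Suc (w (i div 2)) * M \<le> N * M"
      using assms(2) by (intro mult_le_mono1) (simp add: Suc_leI)
    moreover have "1 \<le> N * M"
      using assms(2)[of 0] assms(1) \<open>n \<ge> 1\<close> by (simp add: Suc_le_eq)
    ultimately have "signal_lengths M w i \<le> N * M"
      unfolding signal_lengths_def by simp
    moreover have "t i \<le> M" using assms(3)[of i] i assms(5) by simp
    ultimately show ?thesis by simp
  qed
  have "start_time (signal_lengths M w) t j \<le> card {1..<j} * (N * M + M)"
    unfolding start_time_def
    using sum_bounded_above[of "{1..<j}" "\<lambda>i. signal_lengths M w i + t i - 1", OF term_le]
    by simp
  also have "\<dots> < (2 * n) * (N * M + M)"
    using assms by (intro mult_strict_right_mono) auto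
  finally show ?thesis by (simp add: algebra_simps)
qed

text \<open>
  The separating moment is the signal after the first letter \<open>w i < w' i\<close> in which the words differ.
  Both silences number \<open>i\<close> begin at the same time; that of \<open>w\<close> and the gap after it last less than
  \<open>(w i + 1) M + M\<close> steps, and that of \<open>w'\<close> is at least as long.
\<close>

lemma equal_gaps_imp_separated:
  fixes f :: "'a::metric_space \<Rightarrow> 'a"
  assumes far: "\<And>k. dist ((f ^^ k) p) q \<ge> 3 * \<epsilon>" and "M \<ge> 1"
    and z: "shadowed f \<epsilon> (2 * n) (signal_points p q) (signal_lengths M w) t z"
    and z': "shadowed f \<epsilon> (2 * n) (signal_points p q) (signal_lengths M w') t' z'"
    and gaps: "\<And>j. j \<in> {1..<2 * n} \<Longrightarrow> t j = t' j \<and> 1 \<le> t j \<and> t j \<le> M"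
    and "i < n" and agree: "\<And>j. j < i \<Longrightarrow> w j = w' j" and "w i < w' i"
    and N: "\<And>j. j < n \<Longrightarrow> w j < N"
  shows "\<exists>k<n * (2 * (N * M + M)). dist ((f ^^ k) z) ((f ^^ k) z') > \<epsilon>"
proof -
  define a where "a = start_time (signal_lengths M w) t (2 * i + 1)"
  define s where "s = start_time (signal_lengths M w) t (2 * i + 2)"
  define l where "l = s - a"
  have gap: "1 \<le> t (2 * i + 1)" "t (2 * i + 1) \<le> M"
    using gaps[of "2 * i + 1"] \<open>i < n\<close> by auto
  have s: "s = a + (Suc (w i) * M + t (2 * i + 1) - 1)"
    using start_time_Suc[of "2 * i + 1" "signal_lengths M w" t]
    by (simp add: s_def a_def signal_lengths_def)
  have a': "a = start_time (signal_lengths M w') t' (2 * i + 1)"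
    unfolding a_def start_time_def
  proof (rule sum.cong[OF refl])
    fix j assume j: "j \<in> {1..<2 * i + 1}"
    have "odd j \<Longrightarrow> j div 2 < i"
      using j by (auto elim!: oddE)
    then have "signal_lengths M w j = signal_lengths M w' j"
      using agree by (simp add: signal_lengths_def)
    then show "signal_lengths M w j + t j - 1 = signal_lengths M w' j + t' j - 1"
      using gaps[of j] j \<open>i < n\<close> by simp
  qed
  have "Suc (Suc (w i)) * M \<le> Suc (w' i) * M"
    using \<open>w i < w' i\<close> by (intro mult_le_mono1) simp
  then have "l < signal_lengths M w' (2 * i + 1)"
    using gap s \<open>M \<ge> 1\<close> unfolding l_def signal_lengths_def by simp
  moreover have "a + l = s" using s unfolding l_def by simp
  ultimately have "dist ((f ^^ s) z') ((f ^^ l) p) < \<epsilon>"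
    using z' \<open>i < n\<close> a' unfolding shadowed_def signal_points_def
    by (auto dest!: bspec[of _ _ "2 * i + 1"])
  moreover have "dist ((f ^^ s) z) q < \<epsilon>"
    using z \<open>i < n\<close> unfolding shadowed_def signal_points_def s_def signal_lengths_def[of M w "2*i+2"]
    by (auto dest!: bspec[of _ _ "2 * i + 2"] simp: signal_lengths_def[of M w "Suc (Suc (2*i))"])
  moreover have "dist ((f ^^ l) p) q
      \<le> dist ((f ^^ s) z') ((f ^^ l) p) + dist ((f ^^ s) z) ((f ^^ s) z') + dist ((f ^^ s) z) q"
    by (smt (verit) dist_commute dist_triangle)
  ultimately have "dist ((f ^^ s) z) ((f ^^ s) z') > \<epsilon>"
    using far[of l] by linarith
  moreover have "s < n * (2 * (N * M + M))"
    unfolding s_def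
  proof (rule start_time_signal_less)
    show "t j \<le> M" if "j \<in> {1..<2 * n}" for j
      using gaps[OF that] by blast
  qed (use \<open>M \<ge> 1\<close> N \<open>i < n\<close> in auto)
  ultimately show ?thesis by blast
qed

text \<open>
  The alphabet is taken so large that its \<open>n\<close>-letter words outnumber the possible gap patterns by a
  factor of at least \<open>2 ^ n\<close>: each letter comes with at most two gaps, hence accounts for a factor of
  at most \<open>M\<^sup>2\<close> in the number of patterns.
\<close>

lemma many_words_with_equal_gaps:
  fixes t :: "(nat \<Rightarrow> nat) \<Rightarrow> nat \<Rightarrow> nat"
  assumes "M \<ge> 1"
    and gaps: "\<And>w j. w \<in> {..<n} \<rightarrow>\<^sub>E {..<2 * M\<^sup>2} \<Longrightarrow> j \<in> {1..<2 * n} \<Longrightarrow> t w j \<in> {1..M}"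
  shows "\<exists>W \<subseteq> {..<n} \<rightarrow>\<^sub>E {..<2 * M\<^sup>2}. card W \<ge> 2 ^ n \<and>
    (\<forall>w\<in>W. \<forall>w'\<in>W. \<forall>j\<in>{1..<2 * n}. t w j = t w' j)"
proof -
  define words where "words = {..<n} \<rightarrow>\<^sub>E {..<2 * M\<^sup>2}"
  define patterns where "patterns = {1..<2 * n} \<rightarrow>\<^sub>E {1..M}"
  define pattern where "pattern = (\<lambda>w. restrict (t w) {1..<2 * n})"
  have fin: "finite words" "finite patterns"
    unfolding words_def patterns_def by (auto intro!: finite_PiE)
  have maps: "pattern \<in> words \<rightarrow> patterns"
    unfolding pattern_def words_def patterns_def using gaps by auto
  have card_words: "card words = 2 ^ n * M ^ (2 * n)"
    unfolding words_def by (simp add: card_funcsetE power_mult_distrib power_mult)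
  have "card patterns = M ^ (2 * n - 1)"
    unfolding patterns_def by (simp add: card_funcsetE)
  then have card_patterns: "card patterns \<le> M ^ (2 * n)"
    using \<open>M \<ge> 1\<close> by (simp add: power_increasing)
  obtain g where "card (pattern -` {g} \<inter> words) * card patterns \<ge> card words"
    using pigeonhole_card[OF maps fin] \<open>M \<ge> 1\<close> by (auto simp: patterns_def PiE_eq_empty_iff)
  moreover have "card (pattern -` {g} \<inter> words) * card patterns
      \<le> card (pattern -` {g} \<inter> words) * M ^ (2 * n)"
    using card_patterns by (rule mult_le_mono2)
  ultimately have "2 ^ n * M ^ (2 * n) \<le> card (pattern -` {g} \<inter> words) * M ^ (2 * n)"
    using card_words by linarith
  then have "card (pattern -` {g} \<inter> words) \<ge> 2 ^ n"
    using \<open>M \<ge> 1\<close> by simp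
  moreover have "t w j = t w' j" if "pattern w = g" "pattern w' = g" "j \<in> {1..<2 * n}" for w w' j
    using that unfolding pattern_def by (metis restrict_apply')
  ultimately show ?thesis
    unfolding words_def by (intro exI[of _ "pattern -` {g} \<inter> words"]) (auto simp: words_def)
qed

section \<open>Gluing and an orbit that avoids a ball\<close>

lemma nonminimal_imp_orbit_avoids_ball:
  assumes "\<not> minimal_system X f"
  obtains p q \<epsilon> where "p \<in> X" "q \<in> X" "\<epsilon> > 0" "\<And>k. dist ((f ^^ k) p) q \<ge> \<epsilon>"
proof -
  obtain p q where pq: "p \<in> X" "q \<in> X" "q \<notin> closure (range (\<lambda>n::int. int_iterate X f n p))"
    using assms unfolding minimal_system_def by blast
  then obtain \<epsilon> where e: "\<epsilon> > 0" "\<And>n. \<not> dist (int_iterate X f n p) q < \<epsilon>"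
    unfolding closure_approachable by blast
  have "dist ((f ^^ k) p) q \<ge> \<epsilon>" for k
    using e(2)[of "int k"] by (simp add: int_iterate_def)
  then show ?thesis using that pq e(1) by blast
qed

lemma gluing_imp_many_separated:
  fixes f :: "'a::metric_space \<Rightarrow> 'a"
  assumes "gluing_orbit_property X f" and "p \<in> X" and "q \<in> X" and "\<epsilon> > 0"
    and far: "\<And>k. dist ((f ^^ k) p) q \<ge> 3 * \<epsilon>"
  shows "\<exists>T>0. \<forall>n\<ge>1. \<exists>E. finite E \<and> separated_set X f (n * T) \<epsilon> E \<and> card E \<ge> 2 ^ n"
proof -
  obtain M' :: real where "M' > 0" and M': "\<And>k x m. orbit_sequence X k x m \<Longrightarrow>
      \<exists>t. is_gap k t \<and> (\<forall>j\<in>{1..<k}. real (t j) \<le> M') \<and> (\<exists>z\<in>X. shadowed f \<epsilon> k x m t z)"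
    using assms(1) \<open>\<epsilon> > 0\<close> unfolding gluing_orbit_property_def by metis
  define M where "M = nat \<lceil>M'\<rceil>"
  define N where "N = 2 * M\<^sup>2"
  define T where "T = 2 * (N * M + M)"
  have "M \<ge> 1" using \<open>M' > 0\<close> unfolding M_def by linarith
  have le_M: "a \<le> M" if "real a \<le> M'" for a
    using that unfolding M_def by linarith
  have "\<exists>E. finite E \<and> separated_set X f (n * T) \<epsilon> E \<and> card E \<ge> 2 ^ n" if "n \<ge> 1" for n
  proof -
    have "\<exists>t z. (\<forall>j\<in>{1..<2 * n}. t j \<in> {1..M}) \<and> z \<in> X \<and>
        shadowed f \<epsilon> (2 * n) (signal_points p q) (signal_lengths M w) t z" for w
    proof -
      have "orbit_sequence X (2 * n) (signal_points p q) (signal_lengths M w)"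
        using that \<open>p \<in> X\<close> \<open>q \<in> X\<close> \<open>M \<ge> 1\<close>
        by (auto simp: orbit_sequence_def signal_points_def signal_lengths_def)
      from M'[OF this] show ?thesis
        unfolding is_gap_def using le_M by (metis atLeastAtMost_iff)
    qed
    then obtain t z where t: "\<And>w j. j \<in> {1..<2 * n} \<Longrightarrow> t w j \<in> {1..M}"
      and zX: "\<And>w. z w \<in> X"
      and z: "\<And>w. shadowed f \<epsilon> (2 * n) (signal_points p q) (signal_lengths M w) (t w) (z w)"
      by metis
    obtain W where W: "W \<subseteq> {..<n} \<rightarrow>\<^sub>E {..<N}" "card W \<ge> 2 ^ n"
      and W_gaps: "\<And>w w' j. w \<in> W \<Longrightarrow> w' \<in> W \<Longrightarrow> j \<in> {1..<2 * n} \<Longrightarrow> t w j = t w' j"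
      using many_words_with_equal_gaps[of M n t] \<open>M \<ge> 1\<close> t unfolding N_def by metis
    have "finite W"
      using finite_subset[OF W(1)] by (auto intro!: finite_PiE)
    have sep: "\<exists>k<n * T. dist ((f ^^ k) (z w)) ((f ^^ k) (z w')) > \<epsilon>"
      if ww: "w \<in> W" "w' \<in> W" "w \<noteq> w'" for w w'
    proof -
      define i where "i = (LEAST i. w i \<noteq> w' i)"
      have "\<exists>i. w i \<noteq> w' i" using ww(3) by auto
      then have i: "w i \<noteq> w' i" "\<And>j. j < i \<Longrightarrow> w j = w' j"
        unfolding i_def by (rule LeastI_ex) (use not_less_Least in blast)
      have "i < n"
      proof (rule ccontr)
        assume "\<not> i < n"
        then have "w i = undefined" "w' i = undefined"
          using ww W(1) PiE_arb[of _ "{..<n}" "\<lambda>_. {..<N}" i] by auto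
        then show False using i(1) by simp
      qed
      have N: "u j < N" if "u \<in> W" "j < n" for u j
        using that W(1) PiE_mem[of u "{..<n}" "\<lambda>_. {..<N}" j] by auto
      have gaps: "t u j = t v j \<and> 1 \<le> t u j \<and> t u j \<le> M"
        if "u \<in> W" "v \<in> W" "j \<in> {1..<2 * n}" for u v j
        using W_gaps[OF that] t[OF that(3), of u] by auto
      consider "w i < w' i" | "w' i < w i" using i(1) by linarith
      then show ?thesis
      proof cases
        case 1
        show ?thesis unfolding T_def
          using equal_gaps_imp_separated[OF far \<open>M \<ge> 1\<close> z[of w] z[of w'] gaps[OF ww(1,2)]
              \<open>i < n\<close> i(2) 1 N[OF ww(1)]] by simp
      next
        case 2
        have "\<exists>k<n * T. dist ((f ^^ k) (z w')) ((f ^^ k) (z w)) > \<epsilon>" unfolding T_def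
          using equal_gaps_imp_separated[OF far \<open>M \<ge> 1\<close> z[of w'] z[of w] gaps[OF ww(2,1)]
              \<open>i < n\<close> i(2)[symmetric] 2 N[OF ww(2)]] by simp
        then show ?thesis by (simp add: dist_commute)
      qed
    qed
    have "inj_on z W"
    proof (rule inj_onI, rule ccontr)
      fix w w' assume "w \<in> W" "w' \<in> W" "z w = z w'" "w \<noteq> w'"
      then show False using sep[of w w'] \<open>\<epsilon> > 0\<close> by auto
    qed
    then have "card (z ` W) \<ge> 2 ^ n" using W(2) by (simp add: card_image)
    moreover have "separated_set X f (n * T) \<epsilon> (z ` W)"
      unfolding separated_set_def using zX sep by auto
    ultimately show ?thesis using \<open>finite W\<close> by blast
  qed
  moreover have "T > 0" using \<open>M \<ge> 1\<close> by (simp add: T_def)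
  ultimately show ?thesis by blast
qed

theorem theorem1p1:
  fixes X :: "'a::metric_space set" and f :: "'a \<Rightarrow> 'a"
  assumes "X \<noteq> {}" and "compact X"
    and "\<exists>g. homeomorphism X X f g"
    and "\<not> minimal_system X f"
    and "gluing_orbit_property X f"
  shows "topological_entropy X f > 0"
proof -
  have f: "continuous_on X f" "f ` X \<subseteq> X"
    using assms(3) by (auto simp: homeomorphism_def)
  obtain p q \<epsilon> where pq: "p \<in> X" "q \<in> X" "\<epsilon> > 0" "\<And>k. dist ((f ^^ k) p) q \<ge> \<epsilon>"
    using nonminimal_imp_orbit_avoids_ball[OF assms(4)] by metis
  obtain T where "T > 0" and
    T: "\<And>n. n \<ge> 1 \<Longrightarrow> \<exists>E. finite E \<and> separated_set X f (n * T) (\<epsilon> / 3) E \<and> card E \<ge> 2 ^ n"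
    using gluing_imp_many_separated[OF assms(5) pq(1,2), of "\<epsilon> / 3"] pq(3,4) by auto
  have "0 < ereal (ln 2 / real T)" using \<open>T > 0\<close> by simp
  also have "\<dots> \<le> topological_entropy X f"
    using topological_entropy_ge[OF assms(2) f assms(1) _ \<open>T > 0\<close> T] pq(3) by simp
  finally show ?thesis .
qed

end
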